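(* Let $r\geq 1$ and let $f_1,\dots,f_r\colon X\to Y$ be fibrewise maps over $B$. (a) If $h_1,\dots,h_r\colon Y\to Z$ are fibrewise maps over $B$ such that $h_i\simeq_B h_{i+1}$ for all $i=1,\dots,r-1$, then $D_B(h_1\circ f_1,\dots,h_r\circ f_r)\le D_B(f_1,\dots,f_r)$. (b) If $h_1',\dots,h_r'\colon Z\to X$ are fibrewise maps over $B$ such that $h_i'\simeq_B h_{i+1}'$ for all $i=1,\dots,r-1$, then $D_B(f_1\circ h_1',\dots,f_r\circ h_r')\le D_B(f_1,\dots,f_r)$.
   Context: All spaces are topological spaces, all maps are continuous, $I=[0,1]$. A fibrewise space over $B$ is a space $X$ with a map $p_X\colon X\to B$; a fibrewise map $f\colon X\to Y$ satisfies $p_Y\circ f=p_X$. Subspaces are fibrewise by restriction. $f\simeq_B g$ means there is $H\colon X\times I\to Y$ with $p_Y(H(x,t))=p_X(x)$, $H(\cdot,0)=f$, $H(\cdot,1)=g$. For fibrewise maps $f_1,\dots,f_r\colon X\to Y$, $D_B(f_1,\dots,f_r)$ is the least $n\ge 0$ (or $\infty$) such that $X$ has an open cover $\{U_0,\dots,U_n\}$ with $f_s|_{U_i}\simeq_B f_t|_{U_i}$ for all $0\le i\le n$, $1\le s,t\le r$. *)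

theory Defs
  imports "HOL-Analysis.Analysis" "HOL-Library.Extended_Nat"
begin

definition fibrewise_space :: "'b topology \<Rightarrow> 'a topology \<Rightarrow> ('a \<Rightarrow> 'b) \<Rightarrow> bool" where
  "fibrewise_space B X pX \<longleftrightarrow> continuous_map X B pX"

definition fibrewise_map ::
  "'a topology \<Rightarrow> ('a \<Rightarrow> 'b) \<Rightarrow> 'c topology \<Rightarrow> ('c \<Rightarrow> 'b) \<Rightarrow> ('a \<Rightarrow> 'c) \<Rightarrow> bool" where
  "fibrewise_map X pX Y pY f \<longleftrightarrow>
     continuous_map X Y f \<and> (\<forall>x\<in>topspace X. pY (f x) = pX x)"

text \<open>The library homotopy is a map on the product of the unit interval and \<open>X\<close>, in this order;
  the lemma below gives the explicit form on the product of \<open>X\<close> and the unit interval.\<close>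

definition fibrewise_homotopic ::
  "'a topology \<Rightarrow> ('a \<Rightarrow> 'b) \<Rightarrow> 'c topology \<Rightarrow> ('c \<Rightarrow> 'b) \<Rightarrow> ('a \<Rightarrow> 'c) \<Rightarrow> ('a \<Rightarrow> 'c) \<Rightarrow> bool" where
  "fibrewise_homotopic X pX Y pY f g \<longleftrightarrow>
     homotopic_with (\<lambda>k. \<forall>x\<in>topspace X. pY (k x) = pX x) X Y f g"

lemma fibrewise_homotopic_iff:
  "fibrewise_homotopic X pX Y pY f g \<longleftrightarrow>
     (\<exists>H. continuous_map (prod_topology X (top_of_set {0..1::real})) Y H \<and>
          (\<forall>x\<in>topspace X. \<forall>t\<in>{0..1}. pY (H (x, t)) = pX x) \<and>
          (\<forall>x\<in>topspace X. H (x, 0) = f x) \<and>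
          (\<forall>x\<in>topspace X. H (x, 1) = g x))"
  (is "?L \<longleftrightarrow> ?R")
proof -
  have L: "?L \<longleftrightarrow> (\<exists>h. continuous_map (prod_topology (top_of_set {0..1::real}) X) Y h \<and>
          (\<forall>x\<in>topspace X. h (0, x) = f x) \<and> (\<forall>x\<in>topspace X. h (1, x) = g x) \<and>
          (\<forall>t\<in>{0..1}. \<forall>x\<in>topspace X. pY (h (t, x)) = pX x))"
    unfolding fibrewise_homotopic_def by (subst homotopic_with) auto
  have sw: "continuous_map (prod_topology S T) (prod_topology T S) (\<lambda>z. (snd z, fst z))"
    for S :: "'s topology" and T :: "'t topology"
    by (intro continuous_map_pairedI continuous_map_fst continuous_map_snd)
  show ?thesis
  proof
    assume ?L
    then obtain h where "continuous_map (prod_topology (top_of_set {0..1::real}) X) Y h"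
      "\<forall>x\<in>topspace X. h (0, x) = f x" "\<forall>x\<in>topspace X. h (1, x) = g x"
      "\<forall>t\<in>{0..1}. \<forall>x\<in>topspace X. pY (h (t, x)) = pX x"
      unfolding L by blast
    then show ?R
      by (intro exI[of _ "h \<circ> (\<lambda>z. (snd z, fst z))"])
        (use continuous_map_compose[OF sw] in auto)
  next
    assume ?R
    then obtain h where "continuous_map (prod_topology X (top_of_set {0..1::real})) Y h"
      "\<forall>x\<in>topspace X. h (x, 0) = f x" "\<forall>x\<in>topspace X. h (x, 1) = g x"
      "\<forall>x\<in>topspace X. \<forall>t\<in>{0..1}. pY (h (x, t)) = pX x"
      by blast
    then show ?L
      unfolding L
      by (intro exI[of _ "h \<circ> (\<lambda>z. (snd z, fst z))"])
        (use continuous_map_compose[OF sw] in auto)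
  qed
qed

text \<open>The maps are \<open>f 1, \<dots>, f r\<close>. The infimum of the empty set of extended naturals is \<open>\<infinity>\<close>.\<close>

definition fibrewise_distance ::
  "'a topology \<Rightarrow> ('a \<Rightarrow> 'b) \<Rightarrow> 'c topology \<Rightarrow> ('c \<Rightarrow> 'b) \<Rightarrow> nat \<Rightarrow> (nat \<Rightarrow> 'a \<Rightarrow> 'c) \<Rightarrow> enat" where
  "fibrewise_distance X pX Y pY r f =
     Inf {enat n | n. \<exists>U :: nat \<Rightarrow> 'a set.
       (\<forall>i\<le>n. openin X (U i)) \<and> (\<Union>i\<le>n. U i) = topspace X \<and>
       (\<forall>i\<le>n. \<forall>s\<in>{1..r}. \<forall>t\<in>{1..r}.
          fibrewise_homotopic (subtopology X (U i)) pX Y pY (f s) (f t))}"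

end

theory Submission
  imports Defs
begin

text \<open>
  Fibrewise homotopies can be composed: if \<open>F\<close> is a homotopy into \<open>Y\<close> and \<open>G\<close> a homotopy out of \<open>Y\<close>,
  then \<open>(x, t) \<mapsto> G (F (x, t), t)\<close> is again one over the base
  (\<open>fibrewise_homotopic_compose\<close>).  A chain \<open>h 1 \<simeq> h 2 \<simeq> \<dots> \<simeq> h r\<close> makes any two of the maps
  homotopic (\<open>fibrewise_homotopic_chain\<close>).

  Both inequalities transport an open cover without changing its size
  (\<open>fibrewise_distance_le_pullback\<close>).  When the \<open>h i\<close> are composed after the \<open>f i\<close>, the cover of \<open>X\<close>
  is kept: on a member, \<open>f s \<simeq> f t\<close> and \<open>h s \<simeq> h t\<close> compose.  When the \<open>h' i\<close> are composed before the
  \<open>f i\<close>, the cover of \<open>X\<close> is pulled back along \<open>h' 1\<close>.  For \<open>i \<noteq> 1\<close> the map \<open>h' i\<close> need not send a member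
  of the new cover into the corresponding member \<open>U\<close> of the old one, so a homotopy \<open>f s \<simeq> f t\<close> on \<open>U\<close>
  cannot be composed with \<open>h' s \<simeq> h' t\<close> directly; instead one passes through \<open>h' 1\<close>,
  by \<open>f s \<circ> h' s \<simeq> f s \<circ> h' 1 \<simeq> f t \<circ> h' 1 \<simeq> f t \<circ> h' t\<close>,
  where the outer homotopies are defined on the whole domain and only the middle one uses the cover.
\<close>

lemma fibrewise_homotopic_refl:
  "fibrewise_map X pX Y pY f \<Longrightarrow> fibrewise_homotopic X pX Y pY f f"
  by (simp add: fibrewise_homotopic_def fibrewise_map_def)

lemma fibrewise_homotopic_sym:
  "fibrewise_homotopic X pX Y pY f g \<Longrightarrow> fibrewise_homotopic X pX Y pY g f"
  by (simp add: fibrewise_homotopic_def homotopic_with_sym)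

lemma fibrewise_homotopic_trans:
  "\<lbrakk>fibrewise_homotopic X pX Y pY f g; fibrewise_homotopic X pX Y pY g h\<rbrakk>
    \<Longrightarrow> fibrewise_homotopic X pX Y pY f h"
  unfolding fibrewise_homotopic_def by (rule homotopic_with_trans)

lemma fibrewise_homotopic_chain:
  fixes h :: "nat \<Rightarrow> 'a \<Rightarrow> 'c"
  assumes maps: "\<forall>i\<in>{1..r}. fibrewise_map X pX Y pY (h i)"
    and step: "\<forall>i\<in>{1..<r}. fibrewise_homotopic X pX Y pY (h i) (h (i + 1))"
    and s: "s \<in> {1..r}" and t: "t \<in> {1..r}"
  shows "fibrewise_homotopic X pX Y pY (h s) (h t)"
proof -
  have from_first: "1 \<le> i \<Longrightarrow> i \<le> r \<Longrightarrow> fibrewise_homotopic X pX Y pY (h 1) (h i)" for i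
  proof (induction i rule: nat_induct_at_least)
    case base
    then show ?case using maps by (simp add: fibrewise_homotopic_refl)
  next
    case (Suc n)
    then have "fibrewise_homotopic X pX Y pY (h n) (h (n + 1))"
      using step by simp
    with Suc show ?case by (auto intro: fibrewise_homotopic_trans)
  qed
  show ?thesis
    using from_first[of s] from_first[of t] s t
    by (auto intro: fibrewise_homotopic_sym fibrewise_homotopic_trans)
qed

text \<open>The two homotopies are run at the same time parameter.  Compatibility with the base needs
  \<open>F (x, t)\<close> to lie in the space \<open>Y\<close>, which is part of the continuity of \<open>F\<close>.\<close>

lemma fibrewise_homotopic_compose:
  assumes "fibrewise_homotopic X pX Y pY f f'" and "fibrewise_homotopic Y pY Z pZ g g'"
  shows "fibrewise_homotopic X pX Z pZ (g \<circ> f) (g' \<circ> f')"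
proof -
  let ?I = "top_of_set {0..1::real}"
  obtain F where F: "continuous_map (prod_topology X ?I) Y F"
    and F_over: "\<forall>x\<in>topspace X. \<forall>t\<in>{0..1}. pY (F (x, t)) = pX x"
    and F_ends: "\<forall>x\<in>topspace X. F (x, 0) = f x" "\<forall>x\<in>topspace X. F (x, 1) = f' x"
    using assms(1) unfolding fibrewise_homotopic_iff by blast
  obtain G where G: "continuous_map (prod_topology Y ?I) Z G"
    and G_over: "\<forall>y\<in>topspace Y. \<forall>t\<in>{0..1}. pZ (G (y, t)) = pY y"
    and G_ends: "\<forall>y\<in>topspace Y. G (y, 0) = g y" "\<forall>y\<in>topspace Y. G (y, 1) = g' y"
    using assms(2) unfolding fibrewise_homotopic_iff by blast
  let ?K = "G \<circ> (\<lambda>z. (F z, snd z))"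
  have F_in: "F (x, t) \<in> topspace Y" if "x \<in> topspace X" "t \<in> {0..1}" for x t
    using continuous_map_image_subset_topspace[OF F] that by auto
  have "continuous_map (prod_topology X ?I) Z ?K"
    by (rule continuous_map_compose[OF _ G])
      (intro continuous_map_pairedI F continuous_map_snd)
  moreover have "\<forall>x\<in>topspace X. \<forall>t\<in>{0..1}. pZ (?K (x, t)) = pX x"
    using F_in F_over G_over by auto
  moreover have "\<forall>x\<in>topspace X. ?K (x, 0) = (g \<circ> f) x" "\<forall>x\<in>topspace X. ?K (x, 1) = (g' \<circ> f') x"
    using F_in[of _ 0] F_in[of _ 1] F_ends G_ends by auto
  ultimately show ?thesis
    unfolding fibrewise_homotopic_iff by blast
qed

text \<open>Restriction is composition with the constant homotopy of the inclusion.\<close>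

lemma fibrewise_homotopic_subtopology:
  "fibrewise_homotopic X pX Y pY f g \<Longrightarrow> fibrewise_homotopic (subtopology X U) pX Y pY f g"
  using fibrewise_homotopic_compose
    [OF fibrewise_homotopic_refl[of "subtopology X U" pX X pX id]]
  by (simp add: fibrewise_map_def continuous_map_from_subtopology)

text \<open>Preimages of an open cover of \<open>X\<close> form an open cover of \<open>W\<close> with the same index set.
  The map \<open>\<phi>\<close> is the identity for composition after the \<open>f i\<close>, and the first of the inner maps for
  composition before them.\<close>

lemma fibrewise_distance_le_pullback:
  assumes \<phi>: "continuous_map W X \<phi>"
    and pullback: "\<And>U s t. \<lbrakk>openin X U; s \<in> {1..r}; t \<in> {1..r};
          fibrewise_homotopic (subtopology X U) pX Y pY (f s) (f t)\<rbrakk>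
        \<Longrightarrow> fibrewise_homotopic (subtopology W {w \<in> topspace W. \<phi> w \<in> U}) pW Z pZ (g s) (g t)"
  shows "fibrewise_distance W pW Z pZ r g \<le> fibrewise_distance X pX Y pY r f"
  unfolding fibrewise_distance_def
proof (rule Inf_superset_mono, safe)
  fix n and U :: "nat \<Rightarrow> 'b set"
  assume U_open: "\<forall>i\<le>n. openin X (U i)" and cover: "(\<Union>i\<le>n. U i) = topspace X"
    and hom: "\<forall>i\<le>n. \<forall>s\<in>{1..r}. \<forall>t\<in>{1..r}.
          fibrewise_homotopic (subtopology X (U i)) pX Y pY (f s) (f t)"
  let ?V = "\<lambda>i. {w \<in> topspace W. \<phi> w \<in> U i}"
  have "\<forall>i\<le>n. openin W (?V i)"
    using \<phi> U_open by (simp add: openin_continuous_map_preimage)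
  moreover have "(\<Union>i\<le>n. ?V i) = topspace W"
    using cover continuous_map_image_subset_topspace[OF \<phi>] by blast
  moreover have "\<forall>i\<le>n. \<forall>s\<in>{1..r}. \<forall>t\<in>{1..r}.
          fibrewise_homotopic (subtopology W (?V i)) pW Z pZ (g s) (g t)"
    using U_open hom pullback by blast
  ultimately show "\<exists>m. enat n = enat m \<and> (\<exists>V. (\<forall>i\<le>m. openin W (V i)) \<and>
      (\<Union>i\<le>m. V i) = topspace W \<and> (\<forall>i\<le>m. \<forall>s\<in>{1..r}. \<forall>t\<in>{1..r}.
        fibrewise_homotopic (subtopology W (V i)) pW Z pZ (g s) (g t)))"
    by (intro exI[of _ n] exI[of _ ?V] conjI refl)
qed

lemma fibrewise_distance_compose_left:
  assumes maps: "\<forall>i\<in>{1..r}. fibrewise_map Y pY Z pZ (h i)"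
    and chain: "\<forall>i\<in>{1..<r}. fibrewise_homotopic Y pY Z pZ (h i) (h (i + 1))"
  shows "fibrewise_distance X pX Z pZ r (\<lambda>i. h i \<circ> f i) \<le> fibrewise_distance X pX Y pY r f"
proof (rule fibrewise_distance_le_pullback[of X X id])
  fix U s t
  assume "openin X U" and st: "s \<in> {1..r}" "t \<in> {1..r}"
    and "fibrewise_homotopic (subtopology X U) pX Y pY (f s) (f t)"
  moreover have "{x \<in> topspace X. id x \<in> U} = U"
    using openin_subset[OF \<open>openin X U\<close>] by auto
  moreover have "fibrewise_homotopic Y pY Z pZ (h s) (h t)"
    by (rule fibrewise_homotopic_chain[OF maps chain st])
  ultimately show "fibrewise_homotopic (subtopology X {x \<in> topspace X. id x \<in> U}) pX Z pZ
      (h s \<circ> f s) (h t \<circ> f t)"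
    by (simp only: fibrewise_homotopic_compose)
qed simp

lemma fibrewise_distance_compose_right:
  assumes r: "r \<ge> 1"
    and f: "\<forall>i\<in>{1..r}. fibrewise_map X pX Y pY (f i)"
    and maps: "\<forall>i\<in>{1..r}. fibrewise_map Z pZ X pX (h i)"
    and chain: "\<forall>i\<in>{1..<r}. fibrewise_homotopic Z pZ X pX (h i) (h (i + 1))"
  shows "fibrewise_distance Z pZ Y pY r (\<lambda>i. f i \<circ> h i) \<le> fibrewise_distance X pX Y pY r f"
proof (rule fibrewise_distance_le_pullback[of Z X "h 1"])
  have h1: "fibrewise_map Z pZ X pX (h 1)"
    using maps r by simp
  then show "continuous_map Z X (h 1)"
    by (simp add: fibrewise_map_def)
  fix U s t
  assume st: "s \<in> {1..r}" "t \<in> {1..r}"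
    and hom: "fibrewise_homotopic (subtopology X U) pX Y pY (f s) (f t)"
  let ?V = "subtopology Z {z \<in> topspace Z. h 1 z \<in> U}"
  have "fibrewise_map ?V pZ (subtopology X U) pX (h 1)"
    using h1 by (auto simp: fibrewise_map_def continuous_map_in_subtopology
        continuous_map_from_subtopology)
  then have middle: "fibrewise_homotopic ?V pZ Y pY (f s \<circ> h 1) (f t \<circ> h 1)"
    using hom fibrewise_homotopic_refl fibrewise_homotopic_compose by blast
  have to_first: "fibrewise_homotopic ?V pZ Y pY (f i \<circ> h i) (f i \<circ> h 1)" if "i \<in> {1..r}" for i
  proof -
    have "fibrewise_homotopic Z pZ X pX (h i) (h 1)"
      using fibrewise_homotopic_chain[OF maps chain that] r by simp
    then show ?thesis
      using f that
      by (intro fibrewise_homotopic_subtopology fibrewise_homotopic_compose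
          fibrewise_homotopic_refl) auto
  qed
  show "fibrewise_homotopic ?V pZ Y pY (f s \<circ> h s) (f t \<circ> h t)"
    using to_first[OF st(1)] middle to_first[OF st(2)]
    by (blast intro: fibrewise_homotopic_trans fibrewise_homotopic_sym)
qed

theorem proposition5p4:
  fixes B :: "'b topology" and X :: "'x topology" and Y :: "'y topology"
    and pX :: "'x \<Rightarrow> 'b" and pY :: "'y \<Rightarrow> 'b"
    and f :: "nat \<Rightarrow> 'x \<Rightarrow> 'y" and r :: nat
  assumes "r \<ge> 1"
    and "fibrewise_space B X pX" and "fibrewise_space B Y pY"
    and "\<forall>i\<in>{1..r}. fibrewise_map X pX Y pY (f i)"
  shows "(\<forall>(Z :: 'z topology) (pZ :: 'z \<Rightarrow> 'b) (h :: nat \<Rightarrow> 'y \<Rightarrow> 'z).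
            fibrewise_space B Z pZ \<longrightarrow>
            (\<forall>i\<in>{1..r}. fibrewise_map Y pY Z pZ (h i)) \<longrightarrow>
            (\<forall>i\<in>{1..<r}. fibrewise_homotopic Y pY Z pZ (h i) (h (i + 1))) \<longrightarrow>
            fibrewise_distance X pX Z pZ r (\<lambda>i. h i \<circ> f i) \<le> fibrewise_distance X pX Y pY r f)
       \<and> (\<forall>(Z :: 'w topology) (pZ :: 'w \<Rightarrow> 'b) (h' :: nat \<Rightarrow> 'w \<Rightarrow> 'x).
            fibrewise_space B Z pZ \<longrightarrow>
            (\<forall>i\<in>{1..r}. fibrewise_map Z pZ X pX (h' i)) \<longrightarrow>
            (\<forall>i\<in>{1..<r}. fibrewise_homotopic Z pZ X pX (h' i) (h' (i + 1))) \<longrightarrow>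
            fibrewise_distance Z pZ Y pY r (\<lambda>i. f i \<circ> h' i) \<le> fibrewise_distance X pX Y pY r f)"
  using fibrewise_distance_compose_left[of r Y pY]
    fibrewise_distance_compose_right[OF assms(1) assms(4)]
  by blast

end
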